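(* Let $A\in M_2(\mathbb{Z})$ be an expanding matrix whose characteristic polynomial is $x^2+px+q$ with $p$ a positive integer and $q\in\{3,-3\}$. Let $k\in\mathbb{Z}\setminus\{0\}$ and let $v\in\mathbb{R}^2$ be such that $\{v,Av\}$ is linearly independent. Let $\mathcal{D}=\{0,v,kAv\}$. Then $T(A,\mathcal{D})$ is connected if and only if $k=\pm1$.
   Context: A real square matrix is expanding if all its eigenvalues have modulus strictly larger than $1$. For an expanding matrix $A\in M_n(\mathbb{Z})$ and a finite set $\mathcal{D}\subset\mathbb{R}^n$ with $|\mathcal D|=|\det A|$, the self-affine set $T(A,\mathcal{D})$ is the unique nonempty compact set $T$ with $AT=T+\mathcal{D}$; equivalently $T=\{\sum_{i=1}^\infty A^{-i}d_{j_i}: d_{j_i}\in\mathcal{D}\}$. *)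

theory Defs
  imports "HOL-Analysis.Analysis"
begin

text \<open>Complexification of a real square matrix.\<close>
definition cmat :: "real^'n^'n \<Rightarrow> complex^'n^'n" where
  "cmat A = (\<chi> i j. complex_of_real (A $ i $ j))"

text \<open>Expanding: every (complex) eigenvalue, i.e. every root of the characteristic
  polynomial det(zI - A), has modulus strictly larger than 1.\<close>
definition expanding :: "real^'n^'n \<Rightarrow> bool" where
  "expanding A \<longleftrightarrow> (\<forall>z::complex. det (mat z - cmat A) = 0 \<longrightarrow> cmod z > 1)"

definition integer_matrix :: "real^'n^'n \<Rightarrow> bool" where
  "integer_matrix A \<longleftrightarrow> (\<forall>i j. A $ i $ j \<in> \<int>)"

text \<open>The self-affine set T(A,D) = { sum_{i>=1} A^{-i} d_i : d_i in D }.\<close>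
definition self_affine :: "real^'n^'n \<Rightarrow> (real^'n) set \<Rightarrow> (real^'n) set" where
  "self_affine A D = {x. \<exists>d::nat \<Rightarrow> real^'n. (\<forall>i. d i \<in> D) \<and>
      (\<lambda>i. (((*v) (matrix_inv A)) ^^ (Suc i)) (d i)) sums x}"

end

theory Submission
  imports Defs
begin

text \<open>
  Write T for the self-affine set and \<Delta> for the set of differences of digits, so that the
  self-affine set of \<Delta> is T - T. Two pieces T + d and T + e meet iff e - d lies in T - T, and T is
  connected iff no proper part of the digits is separated from the rest. A vector lies in T - T iff
  it starts a bounded orbit of w \<mapsto> A w - \<delta> with \<delta> in \<Delta>. In the coordinates (a, b) of a v + b A v
  this is the orbit of (a, b) \<mapsto> (- q b - x, a - p b - k y) with (x, y) one of seven points of a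
  hexagon. Expansiveness leaves only (p, q) = (1, 3), (2, 3), (3, 3), (1, -3). For k = 1 or k = -1
  finite invariant sets of such orbits give two overlapping pairs of digits. For larger \<bar>k\<bar> an a priori
  bound on b kills, after at most a few steps, all orbits starting at (0, -k) and (1, -k), hence the
  piece T + k A v is isolated.
\<close>

subsection \<open>Self-affine sets of contracting inverses\<close>

lemma invertible_matrix_inv:
  assumes "invertible A"
  shows "A ** matrix_inv A = mat 1 \<and> matrix_inv A ** A = mat 1"
proof -
  obtain B where "A ** B = mat 1 \<and> B ** A = mat 1"
    using assms unfolding invertible_def by blast
  then show ?thesis unfolding matrix_inv_def by (rule someI)
qed

lemma bounded_linear_matrix_funpow:
  fixes B :: "real^'n^'n"
  shows "bounded_linear (((*v) B) ^^ n)"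
proof (induction n)
  case 0
  show ?case by (simp add: bounded_linear_ident id_def)
next
  case (Suc n)
  show ?case
    using bounded_linear_compose[OF matrix_vector_mul_bounded_linear Suc, of B] by (simp add: o_def)
qed

text \<open>Expansion enters as summability of the operator norms of the inverse powers: digit
  series with bounded digits converge absolutely, and \<open>M ^^ n\<close> applied to a bounded
  sequence tends to 0.\<close>

locale contracting_inverse =
  fixes A :: "real^'n^'n"
  assumes invertible: "invertible A"
    and summable_onorm: "summable (\<lambda>n. onorm (((*v) (matrix_inv A)) ^^ n))"
begin

abbreviation M :: "real^'n \<Rightarrow> real^'n" where
  "M \<equiv> (*v) (matrix_inv A)"

lemma M_A [simp]: "M (A *v x) = x"
  by (simp add: matrix_vector_mul_assoc invertible_matrix_inv[OF invertible])

lemma A_M [simp]: "A *v (M x) = x"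
  by (simp add: matrix_vector_mul_assoc invertible_matrix_inv[OF invertible])

lemma self_affineI:
  assumes "\<And>i. d i \<in> D" "(\<lambda>i. (M ^^ Suc i) (d i)) sums x"
  shows "x \<in> self_affine A D"
  using assms unfolding self_affine_def by blast

lemma self_affineE:
  assumes "x \<in> self_affine A D"
  obtains d where "\<forall>i. d i \<in> D" "(\<lambda>i. (M ^^ Suc i) (d i)) sums x"
  using assms unfolding self_affine_def by blast

lemmas bounded_linear_pow = bounded_linear_matrix_funpow[where B = "matrix_inv A"]

lemmas pow_add = linear_add[OF bounded_linear.linear[OF bounded_linear_pow]]
  and pow_diff = linear_diff[OF bounded_linear.linear[OF bounded_linear_pow]]

lemma norm_pow_le: "norm ((M ^^ n) x) \<le> onorm (M ^^ n) * norm x"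
  by (rule onorm[OF bounded_linear_pow])

lemma onorm_pow_tendsto_0: "(\<lambda>n. onorm (M ^^ n) * B) \<longlonglongrightarrow> 0"
  using tendsto_mult_left_zero[OF summable_LIMSEQ_zero[OF summable_onorm]] .

lemma pow_tendsto_0:
  assumes "\<And>n. norm (x n) \<le> B"
  shows "(\<lambda>n. (M ^^ n) (x n)) \<longlonglongrightarrow> 0"
proof (rule Lim_null_comparison[OF _ onorm_pow_tendsto_0])
  have "norm ((M ^^ n) (x n)) \<le> onorm (M ^^ n) * B" for n
    using norm_pow_le[of n "x n"] assms[of n] onorm_pos_le[OF bounded_linear_pow]
    by (meson mult_left_mono order_trans)
  then show "\<forall>\<^sub>F n in sequentially. norm ((M ^^ n) (x n)) \<le> onorm (M ^^ n) * B"
    by simp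
qed

lemma summable_onorm_Suc: "summable (\<lambda>i. onorm (M ^^ Suc i) * B)"
  by (rule summable_mult2, subst summable_Suc_iff[of "\<lambda>i. onorm (M ^^ i)"]) (rule summable_onorm)

lemma norm_digit_le:
  assumes "norm d \<le> B"
  shows "norm ((M ^^ Suc i) d) \<le> onorm (M ^^ Suc i) * B"
  using norm_pow_le[of "Suc i" d] assms onorm_pos_le[OF bounded_linear_pow[of "Suc i"]]
  by (meson mult_left_mono order_trans)

lemma summable_digits:
  assumes "bounded D" "\<And>i. d i \<in> D"
  shows "summable (\<lambda>i. (M ^^ Suc i) (d i))"
proof -
  obtain B where B: "\<And>x. x \<in> D \<Longrightarrow> norm x \<le> B"
    using assms(1) by (auto simp: bounded_iff)
  show ?thesis
    by (rule summable_comparison_test'[OF summable_onorm_Suc[of B]])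
      (rule norm_digit_le, rule B, rule assms(2))
qed

lemma self_affine_nonempty:
  assumes "D \<noteq> {}"
  shows "self_affine A D \<noteq> {}"
proof -
  obtain d where d: "d \<in> D" using assms by blast
  have "summable (\<lambda>i. (M ^^ Suc i) d)"
    using summable_digits[of "{d}" "\<lambda>_. d"] by simp
  then have "(\<Sum>i. (M ^^ Suc i) d) \<in> self_affine A D"
    using d by (intro self_affineI[of "\<lambda>_. d"] summable_sums)
  then show ?thesis by blast
qed

lemma bounded_self_affine:
  assumes "bounded D"
  shows "bounded (self_affine A D)"
proof -
  obtain B where B: "\<And>x. x \<in> D \<Longrightarrow> norm x \<le> B"
    using assms by (auto simp: bounded_iff)
  have "norm x \<le> (\<Sum>i. onorm (M ^^ Suc i) * B)" if x: "x \<in> self_affine A D" for x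
  proof -
    obtain d where d: "\<And>i. d i \<in> D" and s: "(\<lambda>i. (M ^^ Suc i) (d i)) sums x"
      using x unfolding self_affine_def by blast
    have "norm (\<Sum>i. (M ^^ Suc i) (d i)) \<le> (\<Sum>i. onorm (M ^^ Suc i) * B)"
      by (rule norm_suminf_le[OF _ summable_onorm_Suc]) (rule norm_digit_le, rule B, rule d)
    then show ?thesis using s by (simp add: sums_iff)
  qed
  then show ?thesis by (auto simp: bounded_iff)
qed

text \<open>Multiplying a digit series by \<open>A\<close> frees its first digit and shifts the
  others, which is one inclusion of A T = T + D.\<close>

lemma self_affine_expand:
  assumes "t \<in> self_affine A D"
  shows "\<exists>d\<in>D. A *v t - d \<in> self_affine A D"
proof -
  obtain d where d: "\<And>i. d i \<in> D" and s: "(\<lambda>i. (M ^^ Suc i) (d i)) sums t"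
    using assms unfolding self_affine_def by blast
  have "(\<lambda>i. A *v ((M ^^ Suc i) (d i))) sums (A *v t)"
    by (rule bounded_linear.sums[OF matrix_vector_mul_bounded_linear s])
  then have "(\<lambda>i. (M ^^ i) (d i)) sums (A *v t)" by simp
  then have "(\<lambda>i. (M ^^ Suc i) (d (Suc i))) sums (A *v t - d 0)"
    by (subst sums_Suc_iff) simp
  then have "A *v t - d 0 \<in> self_affine A D"
    by (rule self_affineI[rotated]) (rule d)
  then show ?thesis using d by blast
qed

text \<open>Prepending \<open>d\<close> to a digit sequence of \<open>t\<close> gives the other
  inclusion of A T = T + D.\<close>

lemma self_affine_contract:
  assumes "t \<in> self_affine A D" "d \<in> D"
  shows "M (t + d) \<in> self_affine A D"
proof -
  obtain e where e: "\<And>i. e i \<in> D" and s: "(\<lambda>i. (M ^^ Suc i) (e i)) sums t"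
    using assms unfolding self_affine_def by blast
  define f where "f i = (case i of 0 \<Rightarrow> d | Suc j \<Rightarrow> e j)" for i
  have "(\<lambda>i. M ((M ^^ Suc i) (e i))) sums M t"
    by (rule bounded_linear.sums[OF matrix_vector_mul_bounded_linear s])
  then have "(\<lambda>i. (M ^^ Suc (Suc i)) (f (Suc i))) sums M t"
    by (simp add: f_def)
  then have "(\<lambda>i. (M ^^ Suc i) (f i)) sums (M t + M d)"
    by (subst (asm) sums_Suc_iff) (simp add: f_def)
  moreover have "f i \<in> D" for i
    using e assms(2) by (simp add: f_def split: nat.split)
  ultimately show ?thesis
    using self_affineI[of f D] by (simp only: matrix_vector_right_distrib)
qed

text \<open>Picking a digit at each step makes the partial sums telescope to \<open>w\<close> minus
  \<open>M ^^ n\<close> of a point of \<open>W\<close>, and boundedness of \<open>W\<close> sends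
  this remainder to 0. Membership is thus certified by exhibiting a bounded set with such
  choices.\<close>

lemma self_affine_coinduct:
  assumes "bounded W" "\<And>w. w \<in> W \<Longrightarrow> \<exists>d\<in>D. A *v w - d \<in> W"
  shows "W \<subseteq> self_affine A D"
proof
  fix w assume w: "w \<in> W"
  have "\<forall>w\<in>W. \<exists>d. d \<in> D \<and> A *v w - d \<in> W"
    using assms(2) by blast
  then obtain g where g: "\<And>w. w \<in> W \<Longrightarrow> g w \<in> D \<and> A *v w - g w \<in> W"
    unfolding bchoice_iff by blast
  define u where "u n = ((\<lambda>w. A *v w - g w) ^^ n) w" for n
  have uW: "u n \<in> W" for n
    by (induction n) (auto simp: u_def w g)
  have u_Suc: "u (Suc n) = A *v u n - g (u n)" for n
    by (simp add: u_def)
  obtain B where "\<And>x. x \<in> W \<Longrightarrow> norm x \<le> B"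
    using assms(1) by (auto simp: bounded_iff)
  then have lim: "(\<lambda>n. (M ^^ n) (u n)) \<longlonglongrightarrow> 0"
    using uW by (intro pow_tendsto_0) blast
  have psum: "(\<Sum>i<n. (M ^^ Suc i) (g (u i))) = w - (M ^^ n) (u n)" for n
  proof (induction n)
    case 0
    show ?case by (simp add: u_def)
  next
    case (Suc n)
    have "g (u n) = A *v u n - u (Suc n)" by (simp add: u_Suc)
    then have "(M ^^ Suc n) (g (u n)) = (M ^^ Suc n) (A *v u n) - (M ^^ Suc n) (u (Suc n))"
      by (simp only: pow_diff)
    also have "(M ^^ Suc n) (A *v u n) = (M ^^ n) (u n)"
      by (simp only: funpow_Suc_right o_apply M_A)
    finally show ?case using Suc by simp
  qed
  have "(\<lambda>i. (M ^^ Suc i) (g (u i))) sums w"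
    unfolding sums_def psum using tendsto_diff[OF tendsto_const lim] by simp
  moreover have "g (u i) \<in> D" for i
    using g uW by blast
  ultimately show "w \<in> self_affine A D"
    by (rule self_affineI[rotated])
qed

text \<open>The closure of T satisfies the premise of coinduction, so it is contained in T.\<close>

lemma compact_self_affine:
  assumes "finite D"
  shows "compact (self_affine A D)"
proof -
  let ?T = "self_affine A D"
  have b: "bounded ?T"
    by (rule bounded_self_affine[OF finite_imp_bounded[OF assms]])
  have "closure ?T \<subseteq> ?T"
  proof (rule self_affine_coinduct)
    show "bounded (closure ?T)" using b by (rule bounded_closure)
  next
    fix w assume w: "w \<in> closure ?T"
    let ?F = "\<Union>d\<in>D. (\<lambda>x. A *v x - d) -` closure ?T"
    have "closed ?F"
      by (intro closed_UN assms ballI closed_vimage closed_closure continuous_intros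
          matrix_vector_mult_linear_continuous_on)
    moreover have "?T \<subseteq> ?F"
    proof
      fix t assume "t \<in> ?T"
      then obtain d where "d \<in> D" "A *v t - d \<in> ?T" using self_affine_expand by blast
      then show "t \<in> ?F" using closure_subset[of ?T] by auto
    qed
    ultimately have "w \<in> ?F" using w closure_minimal by blast
    then show "\<exists>d\<in>D. A *v w - d \<in> closure ?T" by blast
  qed
  then have "closed ?T"
    using closure_subset_eq by blast
  then show ?thesis using b by (simp add: compact_eq_bounded_closed)
qed

text \<open>A sequence of differences splits termwise into two digit sequences, whose series
  converge separately because \<open>D\<close> is bounded.\<close>

lemma self_affine_differences:
  assumes "finite D"
  shows "x \<in> self_affine A {d - e | d e. d \<in> D \<and> e \<in> D} \<longleftrightarrow>
    (\<exists>s\<in>self_affine A D. \<exists>t\<in>self_affine A D. x = s - t)" (is "x \<in> ?L \<longleftrightarrow> _")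
proof
  assume "x \<in> ?L"
  then obtain \<delta> where \<delta>: "\<forall>i. \<delta> i \<in> {d - e | d e. d \<in> D \<and> e \<in> D}"
    and s: "(\<lambda>i. (M ^^ Suc i) (\<delta> i)) sums x"
    by (rule self_affineE)
  have "\<forall>i. \<exists>d e. d \<in> D \<and> e \<in> D \<and> \<delta> i = d - e" using \<delta> by simp blast
  then obtain d e where de: "\<And>i. d i \<in> D" "\<And>i. e i \<in> D" "\<And>i. \<delta> i = d i - e i"
    unfolding choice_iff by blast
  let ?s = "\<Sum>i. (M ^^ Suc i) (d i)" and ?t = "\<Sum>i. (M ^^ Suc i) (e i)"
  have 1: "(\<lambda>i. (M ^^ Suc i) (d i)) sums ?s" "(\<lambda>i. (M ^^ Suc i) (e i)) sums ?t"
    by (rule summable_sums, rule summable_digits[OF finite_imp_bounded[OF assms]], rule de)+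
  have "(\<lambda>i. (M ^^ Suc i) (\<delta> i)) sums (?s - ?t)"
    using sums_diff[OF 1] by (simp only: pow_diff de(3))
  then have "x = ?s - ?t" using s sums_unique2 by blast
  moreover have "?s \<in> self_affine A D" "?t \<in> self_affine A D"
    by (rule self_affineI[OF _ 1(1)], rule de(1), rule self_affineI[OF _ 1(2)], rule de(2))
  ultimately show "\<exists>s\<in>self_affine A D. \<exists>t\<in>self_affine A D. x = s - t" by blast
next
  assume "\<exists>s\<in>self_affine A D. \<exists>t\<in>self_affine A D. x = s - t"
  then obtain s t where st: "s \<in> self_affine A D" "t \<in> self_affine A D" "x = s - t" by blast
  obtain d where d: "\<forall>i. d i \<in> D" and ds: "(\<lambda>i. (M ^^ Suc i) (d i)) sums s"
    using st(1) by (rule self_affineE)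
  obtain e where e: "\<forall>i. e i \<in> D" and es: "(\<lambda>i. (M ^^ Suc i) (e i)) sums t"
    using st(2) by (rule self_affineE)
  show "x \<in> ?L"
  proof (rule self_affineI)
    show "d i - e i \<in> {d - e | d e. d \<in> D \<and> e \<in> D}" for i
      using d e by blast
    show "(\<lambda>i. (M ^^ Suc i) (d i - e i)) sums x"
      using sums_diff[OF ds es] by (simp only: pow_diff st(3))
  qed
qed

section \<open>Connectedness as overlap of digit pieces\<close>

text \<open>The closed sets \<open>P E\<close> and \<open>P (D - E)\<close> cover T and both meet
  it; if no piece with digit in \<open>E\<close> met a piece with digit outside, they would separate
  T.\<close>

lemma connected_self_affine_imp:
  assumes "finite D" "connected (self_affine A D)" "E \<subseteq> D" "E \<noteq> {}" "E \<noteq> D"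
  shows "\<exists>d\<in>E. \<exists>e\<in>D - E. \<exists>s\<in>self_affine A D. \<exists>t\<in>self_affine A D. s + d = t + e"
proof (rule ccontr)
  assume neg: "\<not> ?thesis"
  let ?T = "self_affine A D"
  have disjoint: "s + d \<noteq> t + e" if "d \<in> E" "e \<in> D - E" "s \<in> ?T" "t \<in> ?T" for s t d e
    using neg that by blast
  \<comment> \<open>\<open>P E\<close> is the union of the pieces \<open>M (t + d)\<close> with t in
    T and d in \<open>E\<close>, written as preimages so that closedness is immediate.\<close>
  define P where "P E = (\<Union>d\<in>E. (\<lambda>x. A *v x - d) -` ?T)" for E
  have cl: "closed (P E)" if "E \<subseteq> D" for E
    unfolding P_def
    using that compact_imp_closed[OF compact_self_affine[OF assms(1)]] finite_subset[OF that assms(1)]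
    by (intro closed_UN ballI closed_vimage continuous_intros
        matrix_vector_mult_linear_continuous_on)
  have ne: "P E \<inter> ?T \<noteq> {}" if E: "E \<subseteq> D" "E \<noteq> {}" for E
  proof -
    obtain d where d: "d \<in> E" using E by blast
    obtain t where t: "t \<in> ?T" using self_affine_nonempty[of D] E by blast
    have "A *v M (t + d) - d \<in> ?T" using t by simp
    then have "M (t + d) \<in> P E" unfolding P_def using d by blast
    moreover have "M (t + d) \<in> ?T" using self_affine_contract d t E by blast
    ultimately show ?thesis by blast
  qed
  have "?T \<subseteq> P E \<union> P (D - E)"
  proof
    fix t assume "t \<in> ?T"
    then obtain d where "d \<in> D" "A *v t - d \<in> ?T" using self_affine_expand by blast
    then show "t \<in> P E \<union> P (D - E)" unfolding P_def by (cases "d \<in> E") auto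
  qed
  moreover have "P E \<inter> P (D - E) \<inter> ?T = {}"
  proof -
    have "x \<notin> P (D - E)" if x: "x \<in> P E" for x
    proof
      assume "x \<in> P (D - E)"
      then obtain e where e: "e \<in> D - E" "A *v x - e \<in> ?T" unfolding P_def by blast
      obtain d where d: "d \<in> E" "A *v x - d \<in> ?T" using x unfolding P_def by blast
      have "(A *v x - d) + d \<noteq> (A *v x - e) + e"
        by (rule disjoint[OF d(1) e(1) d(2) e(2)])
      then show False by simp
    qed
    then show ?thesis by blast
  qed
  moreover have "closed (P E)" "closed (P (D - E))"
    by (rule cl, use assms(3) in blast)+
  ultimately have "P E \<inter> ?T = {} \<or> P (D - E) \<inter> ?T = {}"
    using connected_closedD[OF assms(2)] by blast
  moreover have "P E \<inter> ?T \<noteq> {}"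
    by (rule ne[OF assms(3,4)])
  moreover have "P (D - E) \<inter> ?T \<noteq> {}"
    by (rule ne) (use assms(3,5) in blast)+
  ultimately show False by blast
qed

text \<open>By compactness a separation of T leaves a positive gap that small pieces cannot
  straddle; overlaps between digits then force ever larger pieces to one side, up to T
  itself.\<close>

lemma connected_self_affineI:
  assumes "finite D"
    and overlap: "\<And>E. E \<subseteq> D \<Longrightarrow> E \<noteq> {} \<Longrightarrow> E \<noteq> D \<Longrightarrow>
      \<exists>d\<in>E. \<exists>e\<in>D - E. \<exists>s\<in>self_affine A D. \<exists>t\<in>self_affine A D. s + d = t + e"
  shows "connected (self_affine A D)"
proof (rule ccontr)
  let ?T = "self_affine A D"
  assume "\<not> connected ?T"
  then obtain P Q where PQ: "closed P" "closed Q" "?T \<subseteq> P \<union> Q" "P \<inter> Q \<inter> ?T = {}"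
    "P \<inter> ?T \<noteq> {}" "Q \<inter> ?T \<noteq> {}"
    unfolding connected_closed by blast
  have cT: "compact ?T" by (rule compact_self_affine[OF assms(1)])
  have "compact (?T \<inter> P)" "closed (?T \<inter> Q)" "(?T \<inter> P) \<inter> (?T \<inter> Q) = {}"
    using PQ cT by (auto intro: compact_Int_closed closed_Int compact_imp_closed)
  then obtain \<delta> where \<delta>: "\<delta> > 0" "\<And>x y. x \<in> ?T \<inter> P \<Longrightarrow> y \<in> ?T \<inter> Q \<Longrightarrow> \<delta> \<le> dist x y"
    by (metis separate_compact_closed)
  \<comment> \<open>Every level n piece of T lies on one side: true for small pieces, and it passes from level
    n + 1 to level n because the overlapping subpieces must lie on the same side.\<close>
  define C where "C n \<longleftrightarrow> (\<forall>c. (\<forall>t\<in>?T. (M ^^ n) t + c \<in> ?T) \<longrightarrow>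
      (\<forall>t\<in>?T. (M ^^ n) t + c \<in> P) \<or> (\<forall>t\<in>?T. (M ^^ n) t + c \<in> Q))" for n
  have "\<exists>n. C n"
  proof -
    obtain B where B: "\<And>x. x \<in> ?T \<Longrightarrow> norm x \<le> B"
      using compact_imp_bounded[OF cT] by (auto simp: bounded_iff)
    \<comment> \<open>At a deep level the diameter of a piece, at most
      \<open>onorm (M ^^ n) * (2 * B)\<close>, is below the gap.\<close>
    have "\<forall>\<^sub>F n in sequentially. onorm (M ^^ n) * (2 * B) < \<delta>"
      using order_tendstoD(2)[OF onorm_pow_tendsto_0 \<delta>(1)] .
    then obtain n where n: "onorm (M ^^ n) * (2 * B) < \<delta>"
      using eventually_happens'[OF sequentially_bot] by blast
    have close: "dist ((M ^^ n) s + c) ((M ^^ n) t + c) < \<delta>" if "s \<in> ?T" "t \<in> ?T" for s t c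
    proof -
      have "norm (s - t) \<le> 2 * B"
        using norm_triangle_ineq4[of s t] B[OF that(1)] B[OF that(2)] by linarith
      then have "onorm (M ^^ n) * norm (s - t) \<le> onorm (M ^^ n) * (2 * B)"
        using onorm_pos_le[OF bounded_linear_pow] mult_left_mono by blast
      then show ?thesis
        using norm_pow_le[of n "s - t"] n by (simp add: dist_norm pow_diff)
    qed
    have "C n"
      unfolding C_def
    proof (intro allI impI, rule ccontr)
      fix c assume sub: "\<forall>t\<in>?T. (M ^^ n) t + c \<in> ?T"
        and "\<not> ((\<forall>t\<in>?T. (M ^^ n) t + c \<in> P) \<or> (\<forall>t\<in>?T. (M ^^ n) t + c \<in> Q))"
      then obtain s t where st: "s \<in> ?T" "t \<in> ?T" "(M ^^ n) s + c \<notin> P" "(M ^^ n) t + c \<notin> Q"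
        by blast
      then have "(M ^^ n) s + c \<in> ?T \<inter> Q" "(M ^^ n) t + c \<in> ?T \<inter> P"
        using sub PQ(3) by blast+
      then show False using \<delta>(2) close[OF st(2,1)] by (meson not_less)
    qed
    then show ?thesis ..
  qed
  moreover have "C n" if CS: "C (Suc n)" for n
    unfolding C_def
  proof (intro allI impI)
    fix c assume sub: "\<forall>t\<in>?T. (M ^^ n) t + c \<in> ?T"
    \<comment> \<open>The subpiece for digit \<open>d\<close> is a piece of level
      \<open>Suc n\<close> with translation \<open>(M ^^ Suc n) d + c\<close>.\<close>
    have pt: "(M ^^ Suc n) t + ((M ^^ Suc n) d + c) = (M ^^ n) (M (t + d)) + c" for t d
      by (simp only: pow_add funpow_Suc_right o_apply matrix_vector_right_distrib add.assoc)
    have inT: "(M ^^ n) (M (t + d)) + c \<in> ?T" if "t \<in> ?T" "d \<in> D" for t d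
      using that sub self_affine_contract by blast
    have piece: "(\<forall>t\<in>?T. (M ^^ n) (M (t + d)) + c \<in> P) \<or> (\<forall>t\<in>?T. (M ^^ n) (M (t + d)) + c \<in> Q)"
      if "d \<in> D" for d
      using CS[unfolded C_def, rule_format, of "(M ^^ Suc n) d + c"] inT that by (simp only: pt)
    define E where "E = {d \<in> D. \<forall>t\<in>?T. (M ^^ n) (M (t + d)) + c \<in> P}"
    have expand: "\<exists>d\<in>D. \<exists>s\<in>?T. t = M (s + d)" if t: "t \<in> ?T" for t
    proof -
      obtain d where "d \<in> D" "A *v t - d \<in> ?T" using self_affine_expand[OF t] by blast
      moreover have "t = M ((A *v t - d) + d)" by simp
      ultimately show ?thesis by blast
    qed
    \<comment> \<open>Otherwise the overlap between \<open>E\<close> and its complement yields a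
      point of T in both P and Q.\<close>
    have "E = D \<or> E = {}"
    proof (rule ccontr)
      assume "\<not> ?thesis"
      moreover have "E \<subseteq> D" unfolding E_def by (rule Collect_restrict)
      ultimately obtain d e s t where de: "d \<in> E" "e \<in> D - E" and st: "s \<in> ?T" "t \<in> ?T"
        and eq: "s + d = t + e"
        using overlap[of E] by metis
      have "(M ^^ n) (M (s + d)) + c \<in> P" using de(1) st(1) unfolding E_def by simp
      moreover have "(M ^^ n) (M (s + d)) + c \<in> Q"
        using de(2) st(2) piece[of e] unfolding E_def eq by blast
      moreover have "(M ^^ n) (M (s + d)) + c \<in> ?T"
        using de(1) inT[OF st(1)] unfolding E_def by simp
      ultimately show False using PQ(4) by blast
    qed
    then show "(\<forall>t\<in>?T. (M ^^ n) t + c \<in> P) \<or> (\<forall>t\<in>?T. (M ^^ n) t + c \<in> Q)"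
    proof
      assume "E = D"
      then have "(M ^^ n) (M (s + d)) + c \<in> P" if "s \<in> ?T" "d \<in> D" for s d
        using that unfolding E_def by blast
      then have "\<forall>t\<in>?T. (M ^^ n) t + c \<in> P" using expand by metis
      then show ?thesis ..
    next
      assume "E = {}"
      then have "(M ^^ n) (M (s + d)) + c \<in> Q" if "s \<in> ?T" "d \<in> D" for s d
        using that piece unfolding E_def by blast
      then have "\<forall>t\<in>?T. (M ^^ n) t + c \<in> Q" using expand by metis
      then show ?thesis ..
    qed
  qed
  ultimately have "C 0"
    by (metis zero_induct)
  then have "?T \<subseteq> P \<or> ?T \<subseteq> Q"
    unfolding C_def by (auto dest!: spec[of _ 0])
  then show False using PQ by blast
qed

lemma overlap_iff:
  assumes "finite D"
  shows "e - d \<in> self_affine A {d - e | d e. d \<in> D \<and> e \<in> D} \<longleftrightarrow>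
    (\<exists>s\<in>self_affine A D. \<exists>t\<in>self_affine A D. s + d = t + e)"
proof -
  have "e - d = s - t \<longleftrightarrow> t + e = s + d" for s t
    by (auto simp: algebra_simps)
  then show ?thesis
    unfolding self_affine_differences[OF assms] by metis
qed

lemma connected_self_affine_iff:
  assumes "finite D"
  shows "connected (self_affine A D) \<longleftrightarrow>
    (\<forall>E. E \<subseteq> D \<longrightarrow> E \<noteq> {} \<longrightarrow> E \<noteq> D \<longrightarrow>
      (\<exists>d\<in>E. \<exists>e\<in>D - E. e - d \<in> self_affine A {d - e | d e. d \<in> D \<and> e \<in> D}))"
  unfolding overlap_iff[OF assms]
proof (intro iffI allI impI)
  fix E
  assume "connected (self_affine A D)" "E \<subseteq> D" "E \<noteq> {}" "E \<noteq> D"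
  then show "\<exists>d\<in>E. \<exists>e\<in>D - E. \<exists>s\<in>self_affine A D. \<exists>t\<in>self_affine A D. s + d = t + e"
    by (rule connected_self_affine_imp[OF assms])
next
  assume *: "\<forall>E. E \<subseteq> D \<longrightarrow> E \<noteq> {} \<longrightarrow> E \<noteq> D \<longrightarrow>
    (\<exists>d\<in>E. \<exists>e\<in>D - E. \<exists>s\<in>self_affine A D. \<exists>t\<in>self_affine A D. s + d = t + e)"
  show "connected (self_affine A D)"
    by (rule connected_self_affineI[OF assms]) (rule *[rule_format])
qed

end

subsection \<open>Planar expanding matrices\<close>

text \<open>Evaluating at 0 and 1 identifies \<open>q\<close> with the determinant and
  \<open>p\<close> with minus the trace; the identity is then checked entrywise.\<close>

lemma Cayley_Hamilton_2:
  fixes A :: "real^2^2"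
  assumes "\<forall>x::real. det (mat x - A) = x\<^sup>2 + p * x + q"
  shows "A *v (A *v v) = - (p *\<^sub>R (A *v v)) - q *\<^sub>R v"
proof -
  have q: "q = A $ 1 $ 1 * A $ 2 $ 2 - A $ 1 $ 2 * A $ 2 $ 1"
    using assms[rule_format, of 0] by (simp add: det_2 mat_def)
  have p: "p = - A $ 1 $ 1 - A $ 2 $ 2"
    using assms[rule_format, of 1] q by (simp add: det_2 mat_def algebra_simps)
  show ?thesis
    by (simp add: vec_eq_iff forall_2 matrix_vector_mult_def sum_2 p q algebra_simps)
qed

lemma expanding_real_root:
  fixes A :: "real^2^2"
  assumes "expanding A" "det (mat x - A) = 0"
  shows "\<bar>x\<bar> > 1"
proof -
  have "det (mat (complex_of_real x) - cmat A) = complex_of_real (det (mat x - A))"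
    by (simp add: det_2 mat_def cmat_def)
  then show ?thesis
    using assms unfolding expanding_def by (metis norm_of_real of_real_0)
qed

text \<open>A real root in [-1, 1] contradicts expansion. The intermediate value theorem produces
  one in [-1, 0] if q = 3 and p >= 4, since f(-1) = 4 - p, and one in [0, 1] if q = -3 and p >= 2,
  since f(1) = p - 2.\<close>

lemma expanding_coefficients:
  fixes A :: "real^2^2" and p q :: int
  assumes A: "expanding A"
    and char: "\<forall>x::real. det (mat x - A) = x\<^sup>2 + of_int p * x + of_int q"
    and p: "p > 0" and q: "q = 3 \<or> q = -3"
  shows "p = 1 \<and> q = 3 \<or> p = 2 \<and> q = 3 \<or> p = 3 \<and> q = 3 \<or> p = 1 \<and> q = -3"
proof -
  let ?f = "\<lambda>x::real. x\<^sup>2 + of_int p * x + of_int q"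
  have noroot: "\<not> (\<exists>x. a \<le> x \<and> x \<le> b \<and> ?f x = 0)" if "-1 \<le> a" "b \<le> 1" for a b
    using expanding_real_root[OF A] char that by fastforce
  have cont: "continuous_on S ?f" for S
    by (intro continuous_intros)
  have "p \<le> 3" if "q = 3"
  proof (rule ccontr)
    assume "\<not> p \<le> 3"
    then have "?f (-1) \<le> 0" "0 \<le> ?f 0" using that by simp_all
    then have "\<exists>x. -1 \<le> x \<and> x \<le> 0 \<and> ?f x = 0"
      by (intro IVT' cont) simp_all
    then show False using noroot[of "-1" 0] by simp
  qed
  moreover have "p \<le> 1" if "q = -3"
  proof (rule ccontr)
    assume "\<not> p \<le> 1"
    then have "?f 0 \<le> 0" "0 \<le> ?f 1" using that by simp_all
    then have "\<exists>x. 0 \<le> x \<and> x \<le> 1 \<and> ?f x = 0"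
      by (intro IVT' cont) simp_all
    then show False using noroot[of 0 1] by simp
  qed
  ultimately show ?thesis using p q by auto
qed

section \<open>Summability of the norms of inverse powers\<close>

text \<open>The first n + m terms are a fixed head of m terms plus a tail of at most
  \<open>r\<close> times the first n terms, so every partial sum is at most head / (1 - r).\<close>

lemma summable_if_geometric_recurrence:
  fixes g :: "nat \<Rightarrow> real"
  assumes nonneg: "\<And>n. 0 \<le> g n" and r: "0 \<le> r" "r < 1" and rec: "\<And>n. g (n + m) \<le> r * g n"
  shows "summable g"
proof (rule summableI_nonneg_bounded)
  fix n
  have "sum g {..<n} \<le> sum g {..<n + m}"
    by (rule sum_mono2) (auto simp: nonneg)
  also have "\<dots> = sum g {..<m} + (\<Sum>i<n. g (i + m))"
    by (induction n) auto
  also have "(\<Sum>i<n. g (i + m)) \<le> r * sum g {..<n}"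
    unfolding sum_distrib_left by (rule sum_mono) (rule rec)
  finally have "(1 - r) * sum g {..<n} \<le> sum g {..<m}"
    by (simp add: algebra_simps)
  then show "sum g {..<n} \<le> sum g {..<m} / (1 - r)"
    using r by (simp add: field_simps)
qed (rule nonneg)

text \<open>The recurrence from Cayley-Hamilton controls norms of powers directly: in each of the
  four possible cases the bound on the sum of two consecutive norms is halved after four
  steps.\<close>

lemma contracting_inverse_planar:
  fixes A :: "real^2^2" and p q :: int
  assumes A: "expanding A"
    and char: "\<forall>x::real. det (mat x - A) = x\<^sup>2 + of_int p * x + of_int q"
    and p: "p > 0" and q: "q = 3 \<or> q = -3"
  shows "contracting_inverse A"
proof -
  have "det (mat 0 - A) = of_int q" using char[rule_format, of 0] by simp
  then have "det A = of_int q" by (simp add: det_2 mat_def)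
  then have "det A \<noteq> 0" using q by auto
  then have inv: "invertible A" by (simp add: invertible_det_nz)
  define M where "M = (*v) (matrix_inv A)"
  have MA: "M (A *v x) = x" for x
    by (simp add: M_def matrix_vector_mul_assoc invertible_matrix_inv[OF inv])
  have linear_M: "linear M"
    unfolding M_def by (rule matrix_vector_mul_linear)
  define \<alpha> \<beta> :: real where "\<alpha> = - p / q" and "\<beta> = - 1 / q"
  have M2: "M (M x) = \<alpha> *\<^sub>R M x + \<beta> *\<^sub>R x" for x
  proof -
    \<comment> \<open>Applying \<open>M\<close> twice to the Cayley-Hamilton identity for
      \<open>A\<close> gives a quadratic relation for \<open>M\<close>.\<close>
    have "x = - (of_int p *\<^sub>R M x) - of_int q *\<^sub>R M (M x)"
      using arg_cong[OF Cayley_Hamilton_2[OF char, of x], of "M \<circ> M"]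
      by (simp add: MA linear_diff[OF linear_M] linear_neg[OF linear_M] linear_cmul[OF linear_M])
    then have "of_int q *\<^sub>R M (M x) = - (of_int p *\<^sub>R M x) - x"
      by (simp add: algebra_simps)
    then have "(1 / of_int q) *\<^sub>R (of_int q *\<^sub>R M (M x)) =
        (1 / of_int q) *\<^sub>R (- (of_int p *\<^sub>R M x) - x)" by simp
    then show ?thesis
      using q by (auto simp: \<alpha>_def \<beta>_def scaleR_diff_right)
  qed
  define \<gamma> where "\<gamma> n = onorm (M ^^ n)" for n
  have rec: "(M ^^ (n + 2)) x = \<alpha> *\<^sub>R (M ^^ (n + 1)) x + \<beta> *\<^sub>R (M ^^ n) x" for n x
    by (simp add: M2)
  have \<gamma>_le: "\<gamma> (n + m) \<le> \<bar>c\<bar> * \<gamma> n + \<bar>d\<bar> * \<gamma> (n + 1)"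
    if "\<And>x. (M ^^ (n + m)) x = c *\<^sub>R (M ^^ n) x + d *\<^sub>R (M ^^ (n + 1)) x" for n m c d
    unfolding \<gamma>_def
  proof (rule onorm_le)
    fix x
    have "norm ((M ^^ (n + m)) x) \<le> \<bar>c\<bar> * norm ((M ^^ n) x) + \<bar>d\<bar> * norm ((M ^^ (n + 1)) x)"
      unfolding that by (rule order_trans[OF norm_triangle_ineq]) simp
    also have "\<dots> \<le> \<bar>c\<bar> * (onorm (M ^^ n) * norm x) + \<bar>d\<bar> * (onorm (M ^^ (n + 1)) * norm x)"
      unfolding M_def
      by (intro add_mono mult_left_mono onorm bounded_linear_matrix_funpow abs_ge_zero)
    finally show "norm ((M ^^ (n + m)) x) \<le>
        (\<bar>c\<bar> * onorm (M ^^ n) + \<bar>d\<bar> * onorm (M ^^ (n + 1))) * norm x"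
      by (simp add: algebra_simps)
  qed
  \<comment> \<open>The recurrence expresses four further steps by the first two with small coefficients.\<close>
  define c3 d3 where "c3 = \<alpha> * \<beta>" and "d3 = \<alpha> * \<alpha> + \<beta>"
  define c4 d4 where "c4 = \<alpha> * c3 + \<beta> * \<beta>" and "d4 = \<alpha> * d3 + \<beta> * \<alpha>"
  define c5 d5 where "c5 = \<alpha> * c4 + \<beta> * c3" and "d5 = \<alpha> * d4 + \<beta> * d3"
  have r3: "(M ^^ (n + 3)) x = c3 *\<^sub>R (M ^^ n) x + d3 *\<^sub>R (M ^^ (n + 1)) x" for n x
  proof -
    have "(M ^^ (n + 3)) x = \<alpha> *\<^sub>R (M ^^ (n + 2)) x + \<beta> *\<^sub>R (M ^^ (n + 1)) x"
      using rec[of "n + 1" x] by (simp add: eval_nat_numeral)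
    then show ?thesis
      unfolding rec c3_def d3_def by (simp add: scaleR_add_left scaleR_add_right)
  qed
  have r4: "(M ^^ (n + 4)) x = c4 *\<^sub>R (M ^^ n) x + d4 *\<^sub>R (M ^^ (n + 1)) x" for n x
  proof -
    have "(M ^^ (n + 4)) x = \<alpha> *\<^sub>R (M ^^ (n + 3)) x + \<beta> *\<^sub>R (M ^^ (n + 2)) x"
      using rec[of "n + 2" x] by (simp add: eval_nat_numeral)
    then show ?thesis
      unfolding r3 rec c4_def d4_def by (simp add: scaleR_add_left scaleR_add_right)
  qed
  have r5: "(M ^^ (n + 5)) x = c5 *\<^sub>R (M ^^ n) x + d5 *\<^sub>R (M ^^ (n + 1)) x" for n x
  proof -
    have "(M ^^ (n + 5)) x = \<alpha> *\<^sub>R (M ^^ (n + 4)) x + \<beta> *\<^sub>R (M ^^ (n + 3)) x"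
      using rec[of "n + 3" x] by (simp add: eval_nat_numeral)
    then show ?thesis
      unfolding r3 r4 c5_def d5_def by (simp add: scaleR_add_left scaleR_add_right)
  qed
  have \<gamma>0: "0 \<le> \<gamma> n" for n
    unfolding \<gamma>_def M_def by (rule onorm_pos_le[OF bounded_linear_matrix_funpow])
  \<comment> \<open>The largest of these sums is 40/81, namely \<bar>d4\<bar> + \<bar>d5\<bar> for p
    = 1, q = -3. After only three steps p = q = 3 would give \<bar>d3\<bar> + \<bar>d4\<bar> =
    1.\<close>
  have coeffs: "\<bar>c4\<bar> + \<bar>c5\<bar> \<le> 1 / 2 \<and> \<bar>d4\<bar> + \<bar>d5\<bar> \<le> 1 / 2"
    unfolding c5_def d5_def c4_def d4_def c3_def d3_def \<alpha>_def \<beta>_def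
    using expanding_coefficients[OF A char p q] by (elim disjE conjE) simp_all
  have "\<gamma> (n + 4) + \<gamma> (n + 4 + 1) \<le> 1 / 2 * (\<gamma> n + \<gamma> (n + 1))" for n
  proof -
    have "\<gamma> (n + 4) + \<gamma> (n + 5) \<le> (\<bar>c4\<bar> + \<bar>c5\<bar>) * \<gamma> n + (\<bar>d4\<bar> + \<bar>d5\<bar>) * \<gamma> (n + 1)"
      using \<gamma>_le[OF r4, of n] \<gamma>_le[OF r5, of n] unfolding distrib_right by linarith
    also have "\<dots> \<le> 1 / 2 * \<gamma> n + 1 / 2 * \<gamma> (n + 1)"
      using coeffs \<gamma>0 by (intro add_mono mult_right_mono) simp_all
    finally show ?thesis by (simp add: eval_nat_numeral)
  qed
  then have "summable (\<lambda>n. \<gamma> n + \<gamma> (n + 1))"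
    using \<gamma>0 by (intro summable_if_geometric_recurrence[where r = "1/2" and m = 4]) simp_all
  then have "summable \<gamma>"
    by (rule summable_comparison_test'[where N = 0]) (simp add: \<gamma>0)
  then show ?thesis
    unfolding \<gamma>_def M_def by (intro contracting_inverse.intro inv)
qed

subsection \<open>Orbits of differences\<close>

text \<open>The crude bound \<open>C\<close> makes the supremum S of \<bar>f\<bar> finite; feeding S
  into the one-step estimate gives S \<le> r S + c, which is solved for S.\<close>

lemma bound_bootstrap:
  fixes f :: "'a \<Rightarrow> real"
  assumes "\<And>x. P x \<Longrightarrow> \<bar>f x\<bar> \<le> C" and r: "r < 1"
    and step: "\<And>S x. (\<And>y. P y \<Longrightarrow> \<bar>f y\<bar> \<le> S) \<Longrightarrow> P x \<Longrightarrow> \<bar>f x\<bar> \<le> r * S + c"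
    and x: "P x"
  shows "\<bar>f x\<bar> \<le> c / (1 - r)"
proof -
  define S where "S = (SUP x\<in>Collect P. \<bar>f x\<bar>)"
  have bdd: "bdd_above ((\<lambda>x. \<bar>f x\<bar>) ` Collect P)"
    by (rule bdd_aboveI2[where M = C]) (simp add: assms(1))
  have S: "\<bar>f y\<bar> \<le> S" if "P y" for y
    unfolding S_def using that by (intro cSUP_upper bdd) simp
  have "S \<le> r * S + c"
    unfolding S_def[symmetric] by (subst (1) S_def, rule cSUP_least) (use x in \<open>auto intro: step S\<close>)
  then have "S \<le> c / (1 - r)"
    using r by (simp add: field_simps)
  then show ?thesis using S[OF x] by linarith
qed

text \<open>The differences of (0, 0), (1, 0) and (0, 1), the coefficients of the digits with
  respect to v and k A v.\<close>

definition hexagon :: "(real \<times> real) set" where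
  "hexagon = {(0, 0), (1, 0), (-1, 0), (0, 1), (0, -1), (1, -1), (-1, 1)}"

text \<open>\<open>K a b\<close> stands for membership of a v + b A v in the self-affine set of
  differences. Keeping only a bound on b and the existence of a next orbit point makes the case
  analysis pure real arithmetic.\<close>

locale difference_orbits =
  fixes K :: "real \<Rightarrow> real \<Rightarrow> bool" and p q k :: real
  assumes bounded: "\<exists>C. \<forall>a b. K a b \<longrightarrow> \<bar>b\<bar> \<le> C"
    and step: "K a b \<Longrightarrow> \<exists>(x, y)\<in>hexagon. K (- q * b - x) (a - p * b - k * y)"
begin

lemma step_cases:
  assumes "K a b"
  shows "K (- q * b) (a - p * b) \<or> K (- q * b - 1) (a - p * b) \<or> K (- q * b + 1) (a - p * b)
    \<or> K (- q * b) (a - p * b - k) \<or> K (- q * b) (a - p * b + k)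
    \<or> K (- q * b - 1) (a - p * b + k) \<or> K (- q * b + 1) (a - p * b - k)"
  using step[OF assms] by (simp add: hexagon_def)

text \<open>The hexagon is relaxed to a box, with z for k y, so that orbit estimates become linear
  arithmetic.\<close>

lemma step_bounds:
  assumes "K a b"
  obtains c d x z where "- 1 \<le> x" "x \<le> 1" "- \<bar>k\<bar> \<le> z" "z \<le> \<bar>k\<bar>"
    "K c d" "c = - q * b - x" "d = a - p * b - z"
proof -
  obtain x y where xy: "(x, y) \<in> hexagon" and K: "K (- q * b - x) (a - p * b - k * y)"
    using step[OF assms] by blast
  have "- 1 \<le> x" "x \<le> 1" "- \<bar>k\<bar> \<le> k * y" "k * y \<le> \<bar>k\<bar>"
    using xy unfolding hexagon_def by auto
  from that[OF this K refl refl] show ?thesis .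
qed

lemma bound_by:
  assumes "r < 1"
    and "\<And>S a b. (\<And>a b. K a b \<Longrightarrow> \<bar>b\<bar> \<le> S) \<Longrightarrow> K a b \<Longrightarrow> \<bar>b\<bar> \<le> r * S + c"
    and "K a b"
  shows "\<bar>b\<bar> \<le> c / (1 - r)"
proof -
  obtain C where "\<And>a b. K a b \<Longrightarrow> \<bar>b\<bar> \<le> C" using bounded by blast
  then show ?thesis
    using bound_bootstrap[of "case_prod K" snd C r c "(a, b)"] assms by (simp add: split_paired_all)
qed

text \<open>
  Successive second coordinates satisfy d + p c + q b = e with \<bar>e\<bar> at most 1 + \<bar>k\<bar>. Multiplying the
  characteristic polynomial by a suitable factor makes the coefficient of b dominate the others:
  (X^2 + X + 3)(3 - X), (X^2 + 2X + 3)(X^2 - 6X + 9), and for p = q = 3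
  (X^2 + 3X + 3)(X^4 - 3X^3 + 6X^2 - 9X + 9) = X^6 + 27.
\<close>

lemma bound_1_3:
  assumes pq: "p = 1" "q = 3" and K: "K a b"
  shows "\<bar>b\<bar> \<le> 2 / 3 * (1 + \<bar>k\<bar>)"
proof -
  \<comment> \<open>The product is - X^3 + 2 X^2 + 9: the weights 1 + 2 against 9 give the ratio
    1/3, and the errors enter with weight 3 + 1, hence 4/9.\<close>
  have "\<bar>b\<bar> \<le> (4 / 9 * (1 + \<bar>k\<bar>)) / (1 - 1 / 3)"
  proof (rule bound_by[OF _ _ K])
    fix S a b assume S: "\<And>a b. K a b \<Longrightarrow> \<bar>b\<bar> \<le> S" and K0: "K a b"
    obtain a1 b1 x1 z1 where 1: "- 1 \<le> x1" "x1 \<le> 1" "- \<bar>k\<bar> \<le> z1" "z1 \<le> \<bar>k\<bar>"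
      and K1: "K a1 b1" and e1: "a1 = - 3 * b - x1" "b1 = a - 1 * b - z1"
      using step_bounds[OF K0, unfolded pq] .
    obtain a2 b2 x2 z2 where 2: "- 1 \<le> x2" "x2 \<le> 1" "- \<bar>k\<bar> \<le> z2" "z2 \<le> \<bar>k\<bar>"
      and K2: "K a2 b2" and e2: "a2 = - 3 * b1 - x2" "b2 = a1 - 1 * b1 - z2"
      using step_bounds[OF K1, unfolded pq] .
    obtain a3 b3 x3 z3 where 3: "- 1 \<le> x3" "x3 \<le> 1" "- \<bar>k\<bar> \<le> z3" "z3 \<le> \<bar>k\<bar>"
      and K3: "K a3 b3" and e3: "a3 = - 3 * b2 - x3" "b3 = a2 - 1 * b2 - z3"
      using step_bounds[OF K2, unfolded pq] .
    show "\<bar>b\<bar> \<le> 1 / 3 * S + 4 / 9 * (1 + \<bar>k\<bar>)"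
      using 1 2 3 S[OF K2] S[OF K3] unfolding e3 e2 e1 abs_le_iff ring_distribs by - (rule conjI; linarith)
  qed simp
  then show ?thesis by simp
qed

lemma bound_2_3:
  assumes pq: "p = 2" "q = 3" and K: "K a b"
  shows "\<bar>b\<bar> \<le> 8 / 11 * (1 + \<bar>k\<bar>)"
proof -
  \<comment> \<open>The product is X^4 - 4 X^3 + 27: the ratio is (1 + 4)/27, and the errors enter
    with weight 1 + 6 + 9 = 16.\<close>
  have "\<bar>b\<bar> \<le> (16 / 27 * (1 + \<bar>k\<bar>)) / (1 - 5 / 27)"
  proof (rule bound_by[OF _ _ K])
    fix S a b assume S: "\<And>a b. K a b \<Longrightarrow> \<bar>b\<bar> \<le> S" and K0: "K a b"
    obtain a1 b1 x1 z1 where 1: "- 1 \<le> x1" "x1 \<le> 1" "- \<bar>k\<bar> \<le> z1" "z1 \<le> \<bar>k\<bar>"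
      and K1: "K a1 b1" and e1: "a1 = - 3 * b - x1" "b1 = a - 2 * b - z1"
      using step_bounds[OF K0, unfolded pq] .
    obtain a2 b2 x2 z2 where 2: "- 1 \<le> x2" "x2 \<le> 1" "- \<bar>k\<bar> \<le> z2" "z2 \<le> \<bar>k\<bar>"
      and K2: "K a2 b2" and e2: "a2 = - 3 * b1 - x2" "b2 = a1 - 2 * b1 - z2"
      using step_bounds[OF K1, unfolded pq] .
    obtain a3 b3 x3 z3 where 3: "- 1 \<le> x3" "x3 \<le> 1" "- \<bar>k\<bar> \<le> z3" "z3 \<le> \<bar>k\<bar>"
      and K3: "K a3 b3" and e3: "a3 = - 3 * b2 - x3" "b3 = a2 - 2 * b2 - z3"
      using step_bounds[OF K2, unfolded pq] .
    obtain a4 b4 x4 z4 where 4: "- 1 \<le> x4" "x4 \<le> 1" "- \<bar>k\<bar> \<le> z4" "z4 \<le> \<bar>k\<bar>"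
      and K4: "K a4 b4" and e4: "a4 = - 3 * b3 - x4" "b4 = a3 - 2 * b3 - z4"
      using step_bounds[OF K3, unfolded pq] .
    show "\<bar>b\<bar> \<le> 5 / 27 * S + 16 / 27 * (1 + \<bar>k\<bar>)"
      using 1 2 3 4 S[OF K3] S[OF K4] unfolding e4 e3 e2 e1 abs_le_iff ring_distribs by - (rule conjI; linarith)
  qed simp
  then show ?thesis by simp
qed

lemma bound_3_3:
  assumes pq: "p = 3" "q = 3" and K: "K a b"
  shows "\<bar>b\<bar> \<le> 14 / 13 * (1 + \<bar>k\<bar>)"
proof -
  \<comment> \<open>Only X^6 and 27 remain, so the ratio is 1/27, while the errors enter with weight
    1 + 3 + 6 + 9 + 9 = 28.\<close>
  have "\<bar>b\<bar> \<le> (28 / 27 * (1 + \<bar>k\<bar>)) / (1 - 1 / 27)"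
  proof (rule bound_by[OF _ _ K])
    fix S a b assume S: "\<And>a b. K a b \<Longrightarrow> \<bar>b\<bar> \<le> S" and K0: "K a b"
    obtain a1 b1 x1 z1 where 1: "- 1 \<le> x1" "x1 \<le> 1" "- \<bar>k\<bar> \<le> z1" "z1 \<le> \<bar>k\<bar>"
      and K1: "K a1 b1" and e1: "a1 = - 3 * b - x1" "b1 = a - 3 * b - z1"
      using step_bounds[OF K0, unfolded pq] .
    obtain a2 b2 x2 z2 where 2: "- 1 \<le> x2" "x2 \<le> 1" "- \<bar>k\<bar> \<le> z2" "z2 \<le> \<bar>k\<bar>"
      and K2: "K a2 b2" and e2: "a2 = - 3 * b1 - x2" "b2 = a1 - 3 * b1 - z2"
      using step_bounds[OF K1, unfolded pq] .
    obtain a3 b3 x3 z3 where 3: "- 1 \<le> x3" "x3 \<le> 1" "- \<bar>k\<bar> \<le> z3" "z3 \<le> \<bar>k\<bar>"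
      and K3: "K a3 b3" and e3: "a3 = - 3 * b2 - x3" "b3 = a2 - 3 * b2 - z3"
      using step_bounds[OF K2, unfolded pq] .
    obtain a4 b4 x4 z4 where 4: "- 1 \<le> x4" "x4 \<le> 1" "- \<bar>k\<bar> \<le> z4" "z4 \<le> \<bar>k\<bar>"
      and K4: "K a4 b4" and e4: "a4 = - 3 * b3 - x4" "b4 = a3 - 3 * b3 - z4"
      using step_bounds[OF K3, unfolded pq] .
    obtain a5 b5 x5 z5 where 5: "- 1 \<le> x5" "x5 \<le> 1" "- \<bar>k\<bar> \<le> z5" "z5 \<le> \<bar>k\<bar>"
      and K5: "K a5 b5" and e5: "a5 = - 3 * b4 - x5" "b5 = a4 - 3 * b4 - z5"
      using step_bounds[OF K4, unfolded pq] .
    obtain a6 b6 x6 z6 where 6: "- 1 \<le> x6" "x6 \<le> 1" "- \<bar>k\<bar> \<le> z6" "z6 \<le> \<bar>k\<bar>"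
      and K6: "K a6 b6" and e6: "a6 = - 3 * b5 - x6" "b6 = a5 - 3 * b5 - z6"
      using step_bounds[OF K5, unfolded pq] .
    show "\<bar>b\<bar> \<le> 1 / 27 * S + 28 / 27 * (1 + \<bar>k\<bar>)"
      using 1 2 3 4 5 6 S[OF K6] unfolding e6 e5 e4 e3 e2 e1 abs_le_iff ring_distribs by - (rule conjI; linarith)
  qed simp
  then show ?thesis by simp
qed

text \<open>In X^2 + X - 3 the constant term already dominates 1 + 1, so the multiplier is 1 and the
  ratio is 2/3.\<close>

lemma bound_1_m3:
  assumes pq: "p = 1" "q = - 3" and K: "K a b"
  shows "\<bar>b\<bar> \<le> (1 + \<bar>k\<bar>)"
proof -
  have "\<bar>b\<bar> \<le> (1 / 3 * (1 + \<bar>k\<bar>)) / (1 - 2 / 3)"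
  proof (rule bound_by[OF _ _ K])
    fix S a b assume S: "\<And>a b. K a b \<Longrightarrow> \<bar>b\<bar> \<le> S" and K0: "K a b"
    obtain a1 b1 x1 z1 where 1: "- 1 \<le> x1" "x1 \<le> 1" "- \<bar>k\<bar> \<le> z1" "z1 \<le> \<bar>k\<bar>"
      and K1: "K a1 b1" and e1: "a1 = - (- 3) * b - x1" "b1 = a - 1 * b - z1"
      using step_bounds[OF K0, unfolded pq] .
    obtain a2 b2 x2 z2 where 2: "- 1 \<le> x2" "x2 \<le> 1" "- \<bar>k\<bar> \<le> z2" "z2 \<le> \<bar>k\<bar>"
      and K2: "K a2 b2" and e2: "a2 = - (- 3) * b1 - x2" "b2 = a1 - 1 * b1 - z2"
      using step_bounds[OF K1, unfolded pq] .
    show "\<bar>b\<bar> \<le> 2 / 3 * S + 1 / 3 * (1 + \<bar>k\<bar>)"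
      using 1 2 S[OF K1] S[OF K2] unfolding e2 e1 abs_le_iff ring_distribs by - (rule conjI; linarith)
  qed simp
  then show ?thesis by simp
qed

section \<open>Exclusion of large k\<close>

text \<open>The bound \<open>B\<close> on the second coordinates of the next two orbit points is
  pulled back to (a, b), the unknown digits being estimated through the box. The resulting necessary
  conditions depend on (a, b) alone.\<close>

lemma iterated_bounds:
  assumes B: "\<forall>a b. K a b \<longrightarrow> \<bar>b\<bar> \<le> B" and K: "K a b"
  shows "\<bar>b\<bar> \<le> B" "\<bar>a - p * b\<bar> \<le> \<bar>k\<bar> + B"
    "\<bar>- q * b - p * (a - p * b)\<bar> \<le> 1 + \<bar>p\<bar> * \<bar>k\<bar> + \<bar>k\<bar> + B"
proof -
  show "\<bar>b\<bar> \<le> B" using B K by blast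
  obtain a1 b1 x z where 1: "- 1 \<le> x" "x \<le> 1" "- \<bar>k\<bar> \<le> z" "z \<le> \<bar>k\<bar>"
    and K1: "K a1 b1" and e1: "a1 = - q * b - x" "b1 = a - p * b - z"
    using step_bounds[OF K] .
  obtain a2 b2 u w where 2: "- 1 \<le> u" "u \<le> 1" "- \<bar>k\<bar> \<le> w" "w \<le> \<bar>k\<bar>"
    and K2: "K a2 b2" and e2: "a2 = - q * b1 - u" "b2 = a1 - p * b1 - w"
    using step_bounds[OF K1] .
  have "\<bar>b1\<bar> \<le> B" "\<bar>b2\<bar> \<le> B" using B K1 K2 by blast+
  then show "\<bar>a - p * b\<bar> \<le> \<bar>k\<bar> + B" using 1 unfolding e1 by linarith
  have "\<bar>p * z\<bar> \<le> \<bar>p\<bar> * \<bar>k\<bar>"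
    unfolding abs_mult using 1 by (intro mult_left_mono) auto
  moreover have "- q * b - p * (a - p * b) = b2 + x - p * z + w"
    unfolding e2 e1 by (simp add: algebra_simps)
  ultimately show "\<bar>- q * b - p * (a - p * b)\<bar> \<le> 1 + \<bar>p\<bar> * \<bar>k\<bar> + \<bar>k\<bar> + B"
    using \<open>\<bar>b2\<bar> \<le> B\<close> 1 2 by linarith
qed

text \<open>Pruning rule of the tree search.\<close>

lemma outside:
  assumes "\<forall>a b. K a b \<longrightarrow> \<bar>b\<bar> \<le> B"
    and "B < \<bar>b\<bar> \<or> \<bar>k\<bar> + B < \<bar>a - p * b\<bar>
      \<or> 1 + \<bar>p\<bar> * \<bar>k\<bar> + \<bar>k\<bar> + B < \<bar>- q * b - p * (a - p * b)\<bar>"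
  shows "\<not> K a b"
  using iterated_bounds[OF assms(1)] assms(2) by (meson not_less)

text \<open>Branching rule of the tree search, the contrapositive of \<open>step_cases\<close>; its
  premise splits into seven goals of the same shape.\<close>

lemma expand:
  assumes "\<not> K (- q * b) (a - p * b) \<and> \<not> K (- q * b - 1) (a - p * b) \<and> \<not> K (- q * b + 1) (a - p * b)
    \<and> \<not> K (- q * b) (a - p * b - k) \<and> \<not> K (- q * b) (a - p * b + k)
    \<and> \<not> K (- q * b - 1) (a - p * b + k) \<and> \<not> K (- q * b + 1) (a - p * b - k)"
  shows "\<not> K a b"
  using assms step_cases[of a b] by blast

text \<open>For fixed parameters, a tree search: a point is discarded if it violates the bounds, otherwise
  it is replaced by its seven successors.\<close>

lemma exterior_1_3:
  fixes n :: int
  assumes pq: "p = 1" "q = 3" and n: "k = of_int n" "\<bar>n\<bar> \<ge> 2"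
  shows "\<not> K 0 (- k) \<and> \<not> K 1 (- k)"
proof (rule ccontr)
  assume K: "\<not> ?thesis"
  have B: "\<forall>a b. K a b \<longrightarrow> \<bar>b\<bar> \<le> 2 / 3 * (1 + \<bar>k\<bar>)"
    using bound_1_3[OF pq] by blast
  \<comment> \<open>The first bound at b = -k reads \<bar>k\<bar> \<le> 2/3 (1 + \<bar>k\<bar>),
    that is, \<bar>k\<bar> \<le> 2.\<close>
  have "n = 2 \<or> n = - 2"
    using K iterated_bounds[OF B, of 0 "- k"] iterated_bounds[OF B, of 1 "- k"] n(2)
    unfolding pq n(1) by (auto simp: abs_if field_simps split: if_splits)
  then have "\<not> K 0 (- k) \<and> \<not> K 1 (- k)"
  proof (elim disjE)
    assume "n = 2"
    then have k: "k = 2" using n(1) by simp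
    show ?thesis
      unfolding k by (intro conjI; ((rule outside[OF B, unfolded pq k], simp; fail) |
        (rule expand[unfolded pq k], simp, (intro conjI)?))+)
  next
    assume "n = - 2"
    then have k: "k = - 2" using n(1) by simp
    show ?thesis
      unfolding k by (intro conjI; ((rule outside[OF B, unfolded pq k], simp; fail) |
        (rule expand[unfolded pq k], simp, (intro conjI)?))+)
  qed
  then show False using K by blast
qed

lemma exterior_2_3:
  fixes n :: int
  assumes pq: "p = 2" "q = 3" and n: "k = of_int n" "\<bar>n\<bar> \<ge> 2"
  shows "\<not> K 0 (- k) \<and> \<not> K 1 (- k)"
proof (rule ccontr)
  assume K: "\<not> ?thesis"
  have B: "\<forall>a b. K a b \<longrightarrow> \<bar>b\<bar> \<le> 8 / 11 * (1 + \<bar>k\<bar>)"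
    using bound_2_3[OF pq] by blast
  \<comment> \<open>The first bound reads \<bar>k\<bar> \<le> 8/11 (1 + \<bar>k\<bar>), that is,
    \<bar>k\<bar> \<le> 8/3.\<close>
  have "n = 2 \<or> n = - 2"
    using K iterated_bounds[OF B, of 0 "- k"] iterated_bounds[OF B, of 1 "- k"] n(2)
    unfolding pq n(1) by (auto simp: abs_if field_simps split: if_splits)
  then have "\<not> K 0 (- k) \<and> \<not> K 1 (- k)"
  proof (elim disjE)
    assume "n = 2"
    then have k: "k = 2" using n(1) by simp
    show ?thesis
      unfolding k by (intro conjI; ((rule outside[OF B, unfolded pq k], simp; fail) |
        (rule expand[unfolded pq k], simp, (intro conjI)?))+)
  next
    assume "n = - 2"
    then have k: "k = - 2" using n(1) by simp
    show ?thesis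
      unfolding k by (intro conjI; ((rule outside[OF B, unfolded pq k], simp; fail) |
        (rule expand[unfolded pq k], simp, (intro conjI)?))+)
  qed
  then show False using K by blast
qed

lemma exterior_3_3:
  fixes n :: int
  assumes pq: "p = 3" "q = 3" and n: "k = of_int n" "\<bar>n\<bar> \<ge> 2"
  shows "\<not> K 0 (- k) \<and> \<not> K 1 (- k)"
proof (rule ccontr)
  assume K: "\<not> ?thesis"
  have B: "\<forall>a b. K a b \<longrightarrow> \<bar>b\<bar> \<le> 14 / 13 * (1 + \<bar>k\<bar>)"
    using bound_3_3[OF pq] by blast
  \<comment> \<open>Here \<open>B\<close> exceeds \<bar>k\<bar> and the second bound decides: for
    \<bar>k\<bar> >= 2 the value \<bar>3 k\<bar> at (0, -k) is always too large, and \<bar>1 + 3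
    k\<bar> at (1, -k) is admissible only for k = -2.\<close>
  have "n = - 2"
    using K iterated_bounds[OF B, of 0 "- k"] iterated_bounds[OF B, of 1 "- k"] n(2)
    unfolding pq n(1) by (auto simp: abs_if field_simps split: if_splits)
  then have k: "k = - 2" using n(1) by simp
  have "\<not> K 0 (- k) \<and> \<not> K 1 (- k)"
    unfolding k by (intro conjI; ((rule outside[OF B, unfolded pq k], simp; fail) |
        (rule expand[unfolded pq k], simp, (intro conjI)?))+)
  then show False using K by blast
qed

lemma exterior_1_m3:
  fixes n :: int
  assumes pq: "p = 1" "q = - 3" and n: "k = of_int n" "\<bar>n\<bar> \<ge> 2"
  shows "\<not> K 0 (- k) \<and> \<not> K 1 (- k)"
proof (rule ccontr)
  assume K: "\<not> ?thesis"
  have B: "\<forall>a b. K a b \<longrightarrow> \<bar>b\<bar> \<le> (1 + \<bar>k\<bar>)"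
    using bound_1_m3[OF pq] by blast
  \<comment> \<open>The third bound decides: \<bar>a + 4 k\<bar> \<le> 2 + 3 \<bar>k\<bar> leaves k
    = 2, -2 for a = 0 and k = -2, -3 for a = 1.\<close>
  have "n = 2 \<or> n = - 2 \<or> n = - 3"
    using K iterated_bounds[OF B, of 0 "- k"] iterated_bounds[OF B, of 1 "- k"] n(2)
    unfolding pq n(1) by (auto simp: abs_if field_simps split: if_splits)
  then have "\<not> K 0 (- k) \<and> \<not> K 1 (- k)"
  proof (elim disjE)
    assume "n = 2"
    then have k: "k = 2" using n(1) by simp
    show ?thesis
      unfolding k by (intro conjI; ((rule outside[OF B, unfolded pq k], simp; fail) |
        (rule expand[unfolded pq k], simp, (intro conjI)?))+)
  next
    assume "n = - 2"
    then have k: "k = - 2" using n(1) by simp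
    show ?thesis
      unfolding k by (intro conjI; ((rule outside[OF B, unfolded pq k], simp; fail) |
        (rule expand[unfolded pq k], simp, (intro conjI)?))+)
  next
    assume "n = - 3"
    then have k: "k = - 3" using n(1) by simp
    show ?thesis
      unfolding k by (intro conjI; ((rule outside[OF B, unfolded pq k], simp; fail) |
        (rule expand[unfolded pq k], simp, (intro conjI)?))+)
  qed
  then show False using K by blast
qed

end

subsection \<open>The digits 0, v and kAv\<close>

locale planar_digits = contracting_inverse A for A :: "real^2^2" +
  fixes v :: "real^2" and p q k :: real
  assumes char: "A *v (A *v v) = - (p *\<^sub>R (A *v v)) - q *\<^sub>R v"
    and v: "v \<noteq> A *v v" "independent {v, A *v v}"
begin

definition emb :: "real \<Rightarrow> real \<Rightarrow> real^2" where
  "emb a b = a *\<^sub>R v + b *\<^sub>R (A *v v)"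

lemma emb_diff: "emb a b - emb c d = emb (a - c) (b - d)"
  by (simp add: emb_def algebra_simps)

lemma A_emb: "A *v emb a b = emb (- q * b) (a - p * b)"
  by (simp add: emb_def char matrix_vector_right_distrib matrix_vector_mult_scaleR algebra_simps)

lemma emb_eq_0_iff: "emb a b = 0 \<longleftrightarrow> a = 0 \<and> b = 0"
proof
  assume emb: "emb a b = 0"
  define u where "u x = (if x = v then a else b)" for x
  have "(\<Sum>x\<in>{v, A *v v}. u x *\<^sub>R x) = 0"
    using v(1) emb by (simp add: u_def emb_def)
  then have "u v = 0" "u (A *v v) = 0"
    using independentD[OF v(2), of "{v, A *v v}" u] by simp_all
  then show "a = 0 \<and> b = 0" using v(1) by (simp add: u_def)
qed (simp add: emb_def)

text \<open>An injective linear map on a finite-dimensional space is bounded below; this turns norm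
  bounds in the plane into bounds on the coordinate b.\<close>

lemma emb_bounded_below:
  "\<exists>B>0. \<forall>a b. B * \<bar>b\<bar> \<le> norm (emb a b)"
proof -
  have lin: "linear (case_prod emb)"
    by (rule linearI) (auto simp: emb_def algebra_simps)
  have "inj (case_prod emb)"
    using linear_injective_0[OF lin] by (auto simp: zero_prod_def emb_eq_0_iff)
  then obtain B where B: "B > 0" "\<And>x. B * norm x \<le> norm (case_prod emb x)"
    using linear_inj_bounded_below_pos[OF lin] by blast
  have "B * \<bar>b\<bar> \<le> norm (emb a b)" for a b
  proof -
    have "B * \<bar>b\<bar> \<le> B * norm (a, b)"
      using B(1) norm_snd_le[of b a] by simp
    then show ?thesis using B(2)[of "(a, b)"] by simp
  qed
  with B(1) show ?thesis by blast
qed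

abbreviation D :: "(real^2) set" where
  "D \<equiv> {0, v, k *\<^sub>R (A *v v)}"

lemma differences_eq: "{d - e | d e. d \<in> D \<and> e \<in> D} = (\<lambda>(x, y). emb x (k * y)) ` hexagon"
proof -
  let ?w = "k *\<^sub>R (A *v v)"
  have "{d - e | d e. d \<in> D \<and> e \<in> D} = (\<Union>d\<in>D. (-) d ` D)"
    by blast
  also have "\<dots> = {0 - 0, v - 0, 0 - v, ?w - 0, 0 - ?w, v - ?w, ?w - v}"
    by (simp add: insert_commute)
  finally show ?thesis
    by (simp add: hexagon_def emb_def)
qed

abbreviation K :: "real \<Rightarrow> real \<Rightarrow> bool" where
  "K a b \<equiv> emb a b \<in> self_affine A {d - e | d e. d \<in> D \<and> e \<in> D}"

lemma difference_orbits: "difference_orbits K p q k"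
proof
  have fin: "finite {d - e | d e. d \<in> D \<and> e \<in> D}"
    unfolding differences_eq by (simp add: hexagon_def)
  obtain C where C: "\<And>x. x \<in> self_affine A {d - e | d e. d \<in> D \<and> e \<in> D} \<Longrightarrow> norm x \<le> C"
    using bounded_self_affine[OF finite_imp_bounded[OF fin]] unfolding bounded_iff by blast
  obtain B where B: "B > 0" "\<And>a b. B * \<bar>b\<bar> \<le> norm (emb a b)"
    using emb_bounded_below by blast
  have "\<bar>b\<bar> \<le> C / B" if "K a b" for a b
    using C[OF that] B(2)[of b a] B(1) by (simp add: field_simps)
  then show "\<exists>C. \<forall>a b. K a b \<longrightarrow> \<bar>b\<bar> \<le> C" by blast
next
  fix a b assume "K a b"
  then obtain x y where "(x, y) \<in> hexagon"
    and "A *v emb a b - emb x (k * y) \<in> self_affine A {d - e | d e. d \<in> D \<and> e \<in> D}"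
    using self_affine_expand unfolding differences_eq by fast
  then show "\<exists>(x, y)\<in>hexagon. K (- q * b - x) (a - p * b - k * y)"
    unfolding A_emb emb_diff by blast
qed

text \<open>Coinduction in coordinates: finiteness supplies boundedness, so a finite list of points
  closed under a suitable choice of steps certifies membership.\<close>

lemma K_coinduct:
  assumes "finite W" and "\<forall>(a, b)\<in>W. \<exists>(x, y)\<in>hexagon. (- q * b - x, a - p * b - k * y) \<in> W"
    and "(a, b) \<in> W"
  shows "K a b"
proof -
  have "case_prod emb ` W \<subseteq> self_affine A {d - e | d e. d \<in> D \<and> e \<in> D}"
  proof (rule self_affine_coinduct)
    show "bounded (case_prod emb ` W)"
      using assms(1) by (intro finite_imp_bounded finite_imageI)
  next
    fix w assume "w \<in> case_prod emb ` W"
    then obtain a b where w: "w = emb a b" "(a, b) \<in> W" by auto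
    then obtain x y where xy: "(x, y) \<in> hexagon" "(- q * b - x, a - p * b - k * y) \<in> W"
      using assms(2) by blast
    have "emb x (k * y) \<in> {d - e | d e. d \<in> D \<and> e \<in> D}"
      unfolding differences_eq using xy(1) by force
    moreover have "A *v w - emb x (k * y) \<in> case_prod emb ` W"
      unfolding w A_emb emb_diff using xy(2) by force
    ultimately show "\<exists>d\<in>{d - e | d e. d \<in> D \<and> e \<in> D}. A *v w - d \<in> case_prod emb ` W"
      by (rule bexI[rotated])
  qed
  then show ?thesis using assms(3) by force
qed

lemma K_overlap:
  "v - 0 \<in> self_affine A {d - e | d e. d \<in> D \<and> e \<in> D} \<longleftrightarrow> K 1 0"
  "0 - v \<in> self_affine A {d - e | d e. d \<in> D \<and> e \<in> D} \<longleftrightarrow> K (-1) 0"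
  "k *\<^sub>R (A *v v) - 0 \<in> self_affine A {d - e | d e. d \<in> D \<and> e \<in> D} \<longleftrightarrow> K 0 k"
  "0 - k *\<^sub>R (A *v v) \<in> self_affine A {d - e | d e. d \<in> D \<and> e \<in> D} \<longleftrightarrow> K 0 (- k)"
  "v - k *\<^sub>R (A *v v) \<in> self_affine A {d - e | d e. d \<in> D \<and> e \<in> D} \<longleftrightarrow> K 1 (- k)"
  "k *\<^sub>R (A *v v) - v \<in> self_affine A {d - e | d e. d \<in> D \<and> e \<in> D} \<longleftrightarrow> K (-1) k"
  by (simp_all add: emb_def)

section \<open>Criteria for connectedness in coordinates\<close>

text \<open>With \<open>E\<close> the singleton of k A v, an overlap would have to involve 0 or v,
  with difference (0, -k) or (1, -k).\<close>

lemma not_connectedI: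
  assumes "k \<noteq> 0" "\<not> K 0 (- k) \<and> \<not> K 1 (- k)"
  shows "\<not> connected (self_affine A D)"
proof
  let ?w = "k *\<^sub>R (A *v v)"
  assume "connected (self_affine A D)"
  moreover have "0 \<noteq> ?w" "v \<noteq> ?w"
    using emb_eq_0_iff[of 0 k] emb_eq_0_iff[of 1 "- k"] assms(1) by (auto simp: emb_def)
  then have "{?w} \<subseteq> D" "{?w} \<noteq> {}" "{?w} \<noteq> D" by auto
  ultimately obtain e where "e \<in> D - {?w}"
    "e - ?w \<in> self_affine A {d - e | d e. d \<in> D \<and> e \<in> D}"
    using connected_self_affine_iff[of D] by blast
  then show False
    using assms(2) K_overlap(4,5) by blast
qed

lemma not_connected_if_large:
  fixes n :: int
  assumes pq: "p = 1 \<and> q = 3 \<or> p = 2 \<and> q = 3 \<or> p = 3 \<and> q = 3 \<or> p = 1 \<and> q = - 3"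
    and n: "k = of_int n" "\<bar>n\<bar> \<ge> 2"
  shows "\<not> connected (self_affine A D)"
proof (rule not_connectedI)
  note exterior = difference_orbits.exterior_1_3[OF difference_orbits _ _ n]
    difference_orbits.exterior_2_3[OF difference_orbits _ _ n]
    difference_orbits.exterior_3_3[OF difference_orbits _ _ n]
    difference_orbits.exterior_1_m3[OF difference_orbits _ _ n]
  show "\<not> K 0 (- k) \<and> \<not> K 1 (- k)"
    using pq by (elim disjE conjE) (erule exterior, assumption)+
qed (use n in auto)

text \<open>The overlaps link 0 with v, and k A v with 0 or v, so no proper part of the digits is
  isolated. Both signs appear because the criterion orients each pair from \<open>E\<close> to its
  complement.\<close>

lemma connectedI:
  assumes "K 1 0" "K (-1) 0" "K 0 k \<and> K 0 (- k) \<or> K 1 (- k) \<and> K (-1) k"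
  shows "connected (self_affine A D)"
proof -
  define R where "R d e \<longleftrightarrow> e - d \<in> self_affine A {d - e | d e. d \<in> D \<and> e \<in> D}" for d e
  let ?w = "k *\<^sub>R (A *v v)"
  have R: "R 0 v" "R v 0" "R 0 ?w \<and> R ?w 0 \<or> R ?w v \<and> R v ?w"
    unfolding R_def K_overlap using assms by auto
  have "\<exists>d\<in>E. \<exists>e\<in>D - E. R d e" if E: "E \<subseteq> D" "E \<noteq> {}" "E \<noteq> D" for E
  proof (rule ccontr)
    assume "\<not> ?thesis"
    then have no: "\<not> R d e" if "d \<in> E" "e \<in> D" "e \<notin> E" for d e
      using that by blast
    have 1: "0 \<in> E \<longleftrightarrow> v \<in> E" using no R(1,2) by blast
    have 2: "?w \<in> E \<longleftrightarrow> v \<in> E" using R(3) no 1 by blast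
    show False using 1 2 E by blast
  qed
  then show ?thesis
    unfolding R_def by (subst connected_self_affine_iff) auto
qed

text \<open>The hexagon is symmetric under negation, so orbits are tracked up to sign: the second
  disjunct for a step allows landing in -L, and L together with -L is the invariant set.\<close>

lemma connected_if_closed_orbits:
  assumes "finite L" and "(1, 0) \<in> L" and k: "(0, k) \<in> L \<or> (0, - k) \<in> L \<or> (1, - k) \<in> L"
    and L: "\<forall>(a, b)\<in>L. \<exists>(x, y)\<in>hexagon.
      (- q * b - x, a - p * b - k * y) \<in> L \<or> (q * b + x, - a + p * b + k * y) \<in> L"
  shows "connected (self_affine A D)"
proof -
  define W where "W = L \<union> (\<lambda>(a, b). (- a, - b)) ` L"
  have W: "(a, b) \<in> W \<longleftrightarrow> (a, b) \<in> L \<or> (- a, - b) \<in> L" for a b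
    unfolding W_def by force
  have hexagon_neg: "(- x, - y) \<in> hexagon" if "(x, y) \<in> hexagon" for x y
    using that by (auto simp: hexagon_def)
  have closed: "\<exists>(x, y)\<in>hexagon. (- q * b - x, a - p * b - k * y) \<in> W" if ab: "(a, b) \<in> W" for a b
    using ab unfolding W
  proof
    assume "(a, b) \<in> L"
    then obtain x y where "(x, y) \<in> hexagon"
      "(- q * b - x, a - p * b - k * y) \<in> L \<or> (q * b + x, - a + p * b + k * y) \<in> L"
      using L by blast
    then show "\<exists>(x, y)\<in>hexagon. (- q * b - x, a - p * b - k * y) \<in> L \<or>
        (- (- q * b - x), - (a - p * b - k * y)) \<in> L"
      by (intro bexI[of _ "(x, y)"]) (auto simp: algebra_simps)
  next
    assume "(- a, - b) \<in> L"
    then obtain x y where "(x, y) \<in> hexagon"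
      "(- q * - b - x, - a - p * - b - k * y) \<in> L \<or> (q * - b + x, - (- a) + p * - b + k * y) \<in> L"
      using L by blast
    then show "\<exists>(x, y)\<in>hexagon. (- q * b - x, a - p * b - k * y) \<in> L \<or>
        (- (- q * b - x), - (a - p * b - k * y)) \<in> L"
      by (intro bexI[of _ "(- x, - y)"] hexagon_neg) (auto simp: algebra_simps)
  qed
  have "finite W" using assms(1) by (simp add: W_def)
  then have "K a b" if "(a, b) \<in> W" for a b
    using K_coinduct[of W a b] closed that by blast
  then show ?thesis
    using assms(2) k by (intro connectedI) (auto simp: W)
qed

end

theorem theorem3p2:
  fixes A :: "real^2^2" and p q k :: int and v :: "real^2"
  assumes "integer_matrix A"
    and "expanding A"
    and "\<forall>x::real. det (mat x - A) = x^2 + of_int p * x + of_int q"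
    and "p > 0"
    and "q = 3 \<or> q = -3"
    and "k \<noteq> 0"
    and "v \<noteq> A *v v" and "independent {v, A *v v}"
  shows "connected (self_affine A {0, v, of_int k *\<^sub>R (A *v v)}) \<longleftrightarrow> (k = 1 \<or> k = -1)"
proof -
  have digits: "planar_digits A v (of_int p) (of_int q)"
    using contracting_inverse_planar[OF assms(2-5)] Cayley_Hamilton_2[OF assms(3)] assms(7,8)
    by (intro planar_digits.intro planar_digits_axioms.intro)
  note pq = expanding_coefficients[OF assms(2-5)]
  show ?thesis
  proof
    assume conn: "connected (self_affine A {0, v, of_int k *\<^sub>R (A *v v)})"
    show "k = 1 \<or> k = -1"
    proof (rule ccontr)
      assume "\<not> (k = 1 \<or> k = -1)"
      then have "\<bar>k\<bar> \<ge> 2" using assms(6) by linarith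
      then show False
        using planar_digits.not_connected_if_large[OF digits _ refl] pq conn by auto
    qed
  next
    assume k: "k = 1 \<or> k = -1"
    let ?closed = "\<lambda>L. finite L \<and> (1, 0) \<in> L \<and>
      ((0, of_int k) \<in> L \<or> (0, - of_int k) \<in> L \<or> (1, - of_int k) \<in> L) \<and>
      (\<forall>(a, b)\<in>L. \<exists>(x, y)\<in>hexagon.
        (- of_int q * b - x, a - of_int p * b - of_int k * y) \<in> L \<or>
        (of_int q * b + x, - a + of_int p * b + of_int k * y) \<in> (L :: (real \<times> real) set))"
    have "\<exists>L. ?closed L"
      using pq
    proof (elim disjE conjE)
      assume "p = 1" "q = 3"
      \<comment> \<open>Up to sign, the orbit of (1, 0) enters the cycle (0, 1), (2, 1), (2, 0) if k
        = 1 and the cycle (0, 1), (2, 0) if k = -1.\<close>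
      then have "?closed (if k = 1 then {(1, 0), (0, 1), (2, 1), (2, 0)} else {(1, 0), (0, 1), (2, 0)})"
        using k by (auto simp: hexagon_def)
      then show ?thesis by blast
    next
      assume "p = 2" "q = 3"
      \<comment> \<open>From (1, 0) both orbits cycle, up to sign, through (0, 1) and (2, 0), with
        (3, 1) or (2, 1) in between.\<close>
      then have "?closed (if k = 1 then {(1, 0), (0, 1), (3, 1), (2, 0)} else {(1, 0), (0, 1), (2, 1), (2, 0)})"
        using k by (auto simp: hexagon_def)
      then show ?thesis by blast
    next
      assume "p = 3" "q = 3"
      \<comment> \<open>For k = 1 the orbit ends in (5, 2), fixed up to sign. For k = -1 it passes
        (1, 1) = (1, -k), so the pieces of v and k A v overlap, and ends in (3, 1), fixed up to
        sign.\<close>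
      then have "?closed (if k = 1 then {(1, 0), (0, 1), (4, 2), (5, 2)} else {(1, 0), (1, 1), (3, 1)})"
        using k by (auto simp: hexagon_def)
      then show ?thesis by blast
    next
      assume "p = 1" "q = -3"
      \<comment> \<open>The cycle is (0, 1), (2, 0) for k = 1; for k = -1 the points are those of p
        = q = 3, now with (3, 1) returning to itself without a sign.\<close>
      then have "?closed (if k = 1 then {(1, 0), (0, 1), (2, 0)} else {(1, 0), (1, 1), (3, 1)})"
        using k by (auto simp: hexagon_def)
      then show ?thesis by blast
    qed
    then show "connected (self_affine A {0, v, of_int k *\<^sub>R (A *v v)})"
      using planar_digits.connected_if_closed_orbits[OF digits] by blast
  qed
qed

end
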